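(* For $n\ge2$ let $Q_n(\beta)$ be the specialization $x_{ij}=1$ (for all $i,j$) of the reduced polynomial of the element $w_0^{(n)}=\prod_{1\le i<j\le n}x_{ij}$. Then $$Q_n(\beta-1)=\left(\sum_{m\ge0}\iota(\mathcal{CRY}_{n+1},m)\,\beta^m\right)(1-\beta)^{\binom{n+1}{2}+1},$$ where $\mathcal{CRY}_N$ denotes the Chan–Robbins–Yuen polytope, i.e. the convex polytope of $N\times N$ matrices $(a_{ij})$ with non-negative entries such that (1) $\sum_ia_{ij}=1$ for all $j$ and $\sum_ja_{ij}=1$ for all $i$; (2) $a_{ij}=0$ if $j>i+1$. Here, for an integral convex polytope $\mathcal{P}\subset\mathbb{R}^d$, $\iota(\mathcal{P},m)$ is the number of integer points in $m\mathcal{P}$.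
   Context: Reduced polynomial: work in the commutative polynomial ring in variables $x_{ij}$, $1\le i<j\le n$, over $\mathbb{Z}[\beta]$, and, starting from $\prod_{i<j}x_{ij}$, repeatedly replace (in any monomial) a product $x_{ij}x_{jk}$ with $i<j<k$ by $x_{ik}x_{ij}+x_{jk}x_{ik}+\beta x_{ik}$, in any order, until no monomial contains such a product. The resulting polynomial $Q_n(x_{ij};\beta)$ may depend on the order of the replacements; $Q_n(\beta)$ is its value at $x_{ij}=1$ for all $i<j$ (this value does not depend on the order). *)

theory Defs
  imports
    "HOL-Library.Poly_Mapping"
    "HOL-Computational_Algebra.Polynomial_FPS"
    "Jordan_Normal_Form.Matrix"
begin

section \<open>Reduced polynomials\<close>

text \<open>
  A monomial in the variables \<open>x\<^sub>i\<^sub>j\<close> is its exponent vector; the index \<open>(i, j)\<close> stands for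
  the variable \<open>x\<^sub>i\<^sub>j\<close>.  The coefficient ring \<open>\<int>[\<beta>]\<close> is \<^typ>\<open>int poly\<close>.
\<close>

type_synonym xmonom = "(nat \<times> nat) \<Rightarrow>\<^sub>0 nat"
type_synonym xpoly = "xmonom \<Rightarrow>\<^sub>0 int poly"

definition xvar :: "nat \<Rightarrow> nat \<Rightarrow> xpoly" where
  "xvar i j = Poly_Mapping.single (Poly_Mapping.single (i, j) 1) 1"

definition xbeta :: xpoly where
  "xbeta = Poly_Mapping.single 0 (Polynomial.monom 1 1)"

definition xeval :: "(nat \<times> nat \<Rightarrow> int poly) \<Rightarrow> xpoly \<Rightarrow> int poly" where
  "xeval f p = (\<Sum>u\<in>Poly_Mapping.keys p. Poly_Mapping.lookup p u *
     (\<Prod>v\<in>Poly_Mapping.keys u. f v ^ Poly_Mapping.lookup u v))"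

definition w0 :: "nat \<Rightarrow> xpoly" where
  "w0 n = (\<Prod>(i, j)\<in>{(i, j). 1 \<le> i \<and> i < j \<and> j \<le> n}. xvar i j)"

text \<open>
  One replacement: in a monomial \<open>x\<^sub>i\<^sub>j x\<^sub>j\<^sub>k u\<close> occurring in \<open>p\<close>, with coefficient \<open>c\<close>, the factor
  \<open>x\<^sub>i\<^sub>j x\<^sub>j\<^sub>k\<close> is replaced.  Only variables of \<open>p\<close> and \<open>x\<^sub>i\<^sub>k\<close> are involved, so starting from
  \<open>w0 n\<close> all indices stay in \<open>{1..n}\<close>.
\<close>

inductive reduction_step :: "xpoly \<Rightarrow> xpoly \<Rightarrow> bool" where
  "\<lbrakk> i < j; j < k;
     s = u + Poly_Mapping.single (i, j) 1 + Poly_Mapping.single (j, k) 1;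
     s \<in> Poly_Mapping.keys p; c = Poly_Mapping.lookup p s \<rbrakk>
   \<Longrightarrow> reduction_step p
        (p - Poly_Mapping.single s c + Poly_Mapping.single u c *
           (xvar i k * xvar i j + xvar j k * xvar i k + xbeta * xvar i k))"

definition fully_reduced :: "xpoly \<Rightarrow> bool" where
  "fully_reduced p \<longleftrightarrow> \<not> (\<exists>s\<in>Poly_Mapping.keys p. \<exists>i j k. i < j \<and> j < k \<and>
     Poly_Mapping.lookup s (i, j) > 0 \<and> Poly_Mapping.lookup s (j, k) > 0)"

text \<open>
  The result of the replacement process depends on choices, so being a reduced polynomial of
  \<open>w\<close> is a relation.
\<close>

definition is_reduced_poly_of :: "xpoly \<Rightarrow> xpoly \<Rightarrow> bool" where
  "is_reduced_poly_of Q w \<longleftrightarrow> reduction_step\<^sup>*\<^sup>* w Q \<and> fully_reduced Q"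

section \<open>The Chan--Robbins--Yuen polytope and Ehrhart counting\<close>

text \<open>
  Matrix indices of \<^typ>\<open>real mat\<close> start at 0; the conditions below are invariant under
  shifting both indices by 1.
\<close>

definition CRY :: "nat \<Rightarrow> real mat set" where
  "CRY N = {A \<in> carrier_mat N N.
     (\<forall>i<N. \<forall>j<N. A $$ (i, j) \<ge> 0) \<and>
     (\<forall>j<N. (\<Sum>i<N. A $$ (i, j)) = 1) \<and>
     (\<forall>i<N. (\<Sum>j<N. A $$ (i, j)) = 1) \<and>
     (\<forall>i<N. \<forall>j<N. j > i + 1 \<longrightarrow> A $$ (i, j) = 0)}"

definition ehrhart_count :: "real mat set \<Rightarrow> nat \<Rightarrow> nat" where
  "ehrhart_count P m =
     card {A \<in> (\<lambda>B. of_nat m \<cdot>\<^sub>m B) ` P. elements_mat A \<subseteq> \<int>}"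

end

theory Submission
  imports Defs
begin

text \<open>
  Read a monomial as a multigraph on \<open>{1..n}\<close> and add edges from a source to every vertex, from every
  vertex to a sink, and from the source to the sink.  Let \<open>H\<close> be the numerator of the Ehrhart series of
  the resulting unit flow polytope, of dimension \<open>n\<close> plus the number of edges of the multigraph.
  A flow with values \<open>a\<close> on \<open>(i, j)\<close> and \<open>b\<close> on \<open>(j, k)\<close> can be rerouted along \<open>(i, k)\<close>, and
  inclusion--exclusion over \<open>a \<ge> b\<close> and \<open>a \<le> b\<close> is exactly the replacement rule with
  \<open>\<beta> = t - 1\<close>.  Hence every reduction preserves \<open>H\<close>, extended linearly.  On a fully reduced monomial
  all flows are free, the polytope is a unimodular simplex and \<open>H = 1\<close>, so that \<open>H\<close> of a reduced
  polynomial is its value at \<open>x\<^sub>i\<^sub>j = 1\<close>.  For the complete graph the flow polytope is the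
  Chan--Robbins--Yuen polytope.
\<close>

section \<open>Generating functions\<close>

text \<open>\<open>card\<close> of an infinite set is 0, so coefficients of \<open>gen_fun\<close>
  are true counts only when all levels are finite; the union and product rules rest on this.\<close>

definition fin_levels :: "'a set \<Rightarrow> ('a \<Rightarrow> nat) \<Rightarrow> bool" where
  "fin_levels S w \<longleftrightarrow> (\<forall>m. finite {x \<in> S. w x = m})"

definition gen_fun :: "'a set \<Rightarrow> ('a \<Rightarrow> nat) \<Rightarrow> int fps" where
  "gen_fun S w = Abs_fps (\<lambda>m. int (card {x \<in> S. w x = m}))"

lemma bij_betw_levels:
  assumes "bij_betw h A B" "\<And>a. a \<in> A \<Longrightarrow> v (h a) = w a"
  shows "bij_betw h {x \<in> A. w x = m} {x \<in> B. v x = m}"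
  using assms unfolding bij_betw_def inj_on_def by fastforce

lemma fin_levels_bij:
  assumes "bij_betw h A B" "\<And>a. a \<in> A \<Longrightarrow> v (h a) = w a"
  shows "fin_levels A w \<longleftrightarrow> fin_levels B v"
  unfolding fin_levels_def using bij_betw_finite[OF bij_betw_levels[of h A B v w, OF assms]] by blast

lemma gen_fun_bij:
  assumes "bij_betw h A B" "\<And>a. a \<in> A \<Longrightarrow> v (h a) = w a"
  shows "gen_fun A w = gen_fun B v"
  unfolding gen_fun_def using bij_betw_same_card[OF bij_betw_levels[of h A B v w, OF assms]] by simp

lemma gen_fun_Un_Int:
  assumes "fin_levels (A \<union> B) w"
  shows "gen_fun A w + gen_fun B w = gen_fun (A \<union> B) w + gen_fun (A \<inter> B) w"
proof (rule fps_ext)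
  fix m
  have fin: "finite {x \<in> A. w x = m}" "finite {x \<in> B. w x = m}"
    using assms by (auto simp: fin_levels_def conj_disj_distribR Collect_disj_eq)
  have U: "{x \<in> A \<union> B. w x = m} = {x \<in> A. w x = m} \<union> {x \<in> B. w x = m}"
    and I: "{x \<in> A \<inter> B. w x = m} = {x \<in> A. w x = m} \<inter> {x \<in> B. w x = m}"
    by auto
  show "fps_nth (gen_fun A w + gen_fun B w) m = fps_nth (gen_fun (A \<union> B) w + gen_fun (A \<inter> B) w) m"
    using card_Un_Int[OF fin]
    by (simp only: gen_fun_def fps_add_nth fps_nth_Abs_fps U I flip: of_nat_add)
qed

lemma gen_fun_Times:
  assumes "fin_levels A v" "fin_levels B w"
  shows "gen_fun (A \<times> B) (\<lambda>(a, b). v a + w b) = gen_fun A v * gen_fun B w"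
proof (rule fps_ext)
  fix m
  have "{x \<in> A \<times> B. (case x of (a, b) \<Rightarrow> v a + w b) = m}
      = (\<Union>i\<in>{0..m}. {a \<in> A. v a = i} \<times> {b \<in> B. w b = m - i})"
    by auto
  moreover have "card \<dots> = (\<Sum>i=0..m. card ({a \<in> A. v a = i} \<times> {b \<in> B. w b = m - i}))"
    using assms by (intro card_UN_disjoint) (auto simp: fin_levels_def)
  ultimately show "fps_nth (gen_fun (A \<times> B) (\<lambda>(a, b). v a + w b)) m = fps_nth (gen_fun A v * gen_fun B w) m"
    by (simp add: gen_fun_def fps_mult_nth card_cartesian_product)
qed

lemma gen_fun_nat: "gen_fun (UNIV :: nat set) (\<lambda>a. a) * (1 - fps_X) = 1"
proof -
  have "gen_fun (UNIV :: nat set) (\<lambda>a. a) = Abs_fps (\<lambda>_. 1)"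
    by (simp add: gen_fun_def)
  moreover have "Abs_fps (\<lambda>_. 1 :: int) * (1 - fps_X) = 1"
    by (rule fps_ext) (simp add: right_diff_distrib)
  ultimately show ?thesis by simp
qed

text \<open>Vanishing off \<open>A\<close> makes a function determined by its values on
  \<open>A\<close>, so adding an edge to a graph becomes a function update.\<close>

definition supported :: "'a set \<Rightarrow> ('a \<Rightarrow> nat) set" where
  "supported A = {f. \<forall>x. x \<notin> A \<longrightarrow> f x = 0}"

lemma finite_supported_bounded:
  assumes "finite A"
  shows "finite {f \<in> supported A. sum f A \<le> K}"
proof (rule finite_subset)
  show "{f \<in> supported A. sum f A \<le> K}
      \<subseteq> {f. \<forall>x. (x \<in> A \<longrightarrow> f x \<in> {..K}) \<and> (x \<notin> A \<longrightarrow> f x = 0)}"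
  proof (rule subsetI)
    fix f assume f: "f \<in> {f \<in> supported A. sum f A \<le> K}"
    have "f x \<le> K" if "x \<in> A" for x
      using member_le_sum[of x A f] that assms f by auto
    then show "f \<in> {f. \<forall>x. (x \<in> A \<longrightarrow> f x \<in> {..K}) \<and> (x \<notin> A \<longrightarrow> f x = 0)}"
      using f by (auto simp: supported_def)
  qed
  show "finite {f. \<forall>x. (x \<in> A \<longrightarrow> f x \<in> {..K}) \<and> (x \<notin> A \<longrightarrow> f x = 0)}"
    using assms by (intro finite_set_of_finite_funs) auto
qed

lemma bij_betw_supported_insert:
  assumes "x \<notin> A"
  shows "bij_betw (\<lambda>(f, a). f(x := a)) (supported A \<times> UNIV) (supported (insert x A))"
proof (rule bij_betw_byWitness[where f' = "\<lambda>f. (f(x := 0), f x)"])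
qed (use assms in \<open>auto simp: supported_def fun_eq_iff\<close>)

lemma fin_levels_supported:
  assumes "finite A"
  shows "fin_levels (supported A) (\<lambda>f. sum f A)"
  unfolding fin_levels_def
proof
  fix m
  show "finite {f \<in> supported A. sum f A = m}"
    by (rule finite_subset[OF _ finite_supported_bounded[OF assms, of m]]) auto
qed

text \<open>One geometric series per element of \<open>A\<close>. The product form avoids inverting
  series over the integers.\<close>

lemma gen_fun_supported:
  assumes "finite A"
  shows "gen_fun (supported A) (\<lambda>f. sum f A) * (1 - fps_X) ^ card A = 1"
  using assms
proof (induction A)
  case empty
  have "supported ({} :: 'a set) = {\<lambda>_. 0}"
    by (auto simp: supported_def)
  then show ?case
    by (intro fps_ext) (auto simp: gen_fun_def)
next
  case (insert x A)
  have "gen_fun (supported A \<times> UNIV) (\<lambda>(f, a). sum f A + a)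
      = gen_fun (supported (insert x A)) (\<lambda>f. sum f (insert x A))"
  proof (rule gen_fun_bij[OF bij_betw_supported_insert])
    fix z assume "z \<in> supported A \<times> (UNIV :: nat set)"
    then show "sum ((\<lambda>(f, a). f(x := a)) z) (insert x A) = (\<lambda>(f, a). sum f A + a) z"
      using insert by (auto simp: sum.insert intro!: sum.cong split: prod.splits)
  qed (use insert in auto)
  also have "gen_fun (supported A \<times> UNIV) (\<lambda>(f, a). sum f A + a)
      = gen_fun (supported A) (\<lambda>f. sum f A) * gen_fun UNIV (\<lambda>a. a)"
    by (rule gen_fun_Times[OF fin_levels_supported])
      (use insert in \<open>auto simp: fin_levels_def\<close>)
  finally have eq: "gen_fun (supported (insert x A)) (\<lambda>f. sum f (insert x A))
      = gen_fun (supported A) (\<lambda>f. sum f A) * gen_fun UNIV (\<lambda>a. a)" ..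
  have "gen_fun (supported (insert x A)) (\<lambda>f. sum f (insert x A)) * (1 - fps_X) ^ card (insert x A)
      = (gen_fun (supported A) (\<lambda>f. sum f A) * (1 - fps_X) ^ card A)
      * (gen_fun UNIV (\<lambda>a. a) * (1 - fps_X))"
    unfolding eq using insert by (simp add: mult_ac)
  then show ?case using insert gen_fun_nat by simp
qed

section \<open>Flows on the multigraph of a monomial\<close>

text \<open>
  The monomial \<open>u\<close> is read as a multigraph; \<open>(v, r)\<close> with \<open>r < u v\<close> is the \<open>r\<close>-th copy of the
  edge \<open>v\<close>.
\<close>

definition edge_copies :: "xmonom \<Rightarrow> ((nat \<times> nat) \<times> nat) set" where
  "edge_copies u = {(v, r). r < Poly_Mapping.lookup u v}"

definition edge_monom :: "nat \<times> nat \<Rightarrow> xmonom" where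
  "edge_monom e = Poly_Mapping.single e 1"

definition edge_div :: "nat \<times> nat \<Rightarrow> nat \<Rightarrow> int" where
  "edge_div e i = of_bool (i = fst e) - of_bool (i = snd e)"

definition net_out :: "xmonom \<Rightarrow> ((nat \<times> nat) \<times> nat \<Rightarrow> nat) \<Rightarrow> nat \<Rightarrow> int" where
  "net_out u f i = (\<Sum>x\<in>edge_copies u. int (f x) * edge_div (fst x) i)"

text \<open>
  The amount that has to be supplied from outside to realise the divergence \<open>d\<close> on \<open>{1..n}\<close>;
  \<^const>\<open>nat\<close> is the positive part.
\<close>

definition inflow :: "nat \<Rightarrow> (nat \<Rightarrow> int) \<Rightarrow> nat" where
  "inflow n d = (\<Sum>i=1..n. nat (d i))"

definition flow_gf :: "nat \<Rightarrow> xmonom \<Rightarrow> int fps" where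
  "flow_gf n u = gen_fun (supported (edge_copies u)) (\<lambda>f. inflow n (net_out u f))"

text \<open>Given the flow inside the graph, the source and sink edges at each vertex carry the
  positive and negative parts of its divergence plus a free common amount. With the source-sink edge
  these are \<open>n + 1\<close> free parameters, so the Ehrhart series is \<open>flow_gf\<close>
  divided by \<open>(1 - fps_X) ^ (n + 1)\<close>, and its numerator has the form below.\<close>

definition hstar :: "nat \<Rightarrow> xmonom \<Rightarrow> int fps" where
  "hstar n u = (1 - fps_X) ^ card (edge_copies u) * flow_gf n u"

definition admissible :: "nat \<Rightarrow> xmonom \<Rightarrow> bool" where
  "admissible n u \<longleftrightarrow> (\<forall>(i, j)\<in>Poly_Mapping.keys u. 1 \<le> i \<and> i < j \<and> j \<le> n)"

lemma finite_edge_copies [simp]: "finite (edge_copies u)"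
proof -
  have "edge_copies u = Sigma (Poly_Mapping.keys u) (\<lambda>v. {..<Poly_Mapping.lookup u v})"
    by (auto simp: edge_copies_def in_keys_iff)
  then show ?thesis by simp
qed

text \<open>Copies are numbered from 0, so the multiplicity of \<open>e\<close> in \<open>u\<close>
  is the next free number.\<close>

lemma edge_copies_add:
  "edge_copies (u + edge_monom e)
    = insert (e, Poly_Mapping.lookup u e) (edge_copies u)"
  by (auto simp: edge_copies_def edge_monom_def lookup_add lookup_single when_def split: if_splits)

lemma new_copy_notin: "(e, Poly_Mapping.lookup u e) \<notin> edge_copies u"
  by (simp add: edge_copies_def)

lemma sum_edge_copies_add:
  "(\<Sum>x\<in>edge_copies (u + edge_monom e). g (fst x))
    = (\<Sum>x\<in>edge_copies u. g (fst x)) + (g e :: 'a :: comm_monoid_add)"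
  by (simp only: edge_copies_add)
    (simp add: new_copy_notin finite_edge_copies add.commute)

lemma card_edge_copies_add:
  "card (edge_copies (u + edge_monom e)) = Suc (card (edge_copies u))"
  by (simp only: edge_copies_add) (simp add: new_copy_notin)

lemma admissible_add:
  "admissible n (u + edge_monom (i, j))
    \<longleftrightarrow> admissible n u \<and> 1 \<le> i \<and> i < j \<and> j \<le> n"
proof -
  have "Poly_Mapping.keys (u + edge_monom (i, j)) = insert (i, j) (Poly_Mapping.keys u)"
    by (auto simp: in_keys_iff edge_monom_def lookup_add lookup_single when_def split: if_splits)
  then show ?thesis by (auto simp: admissible_def)
qed

lemma admissible_copy:
  assumes "admissible n u" "x \<in> edge_copies u"
  shows "1 \<le> fst (fst x)" "fst (fst x) < snd (fst x)" "snd (fst x) \<le> n"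
proof -
  have "fst x \<in> Poly_Mapping.keys u"
    using assms(2) by (auto simp: edge_copies_def in_keys_iff)
  then show "1 \<le> fst (fst x)" "fst (fst x) < snd (fst x)" "snd (fst x) \<le> n"
    using assms(1) by (auto simp: admissible_def)
qed

lemma net_out_upd:
  "net_out (u + edge_monom e) (f((e, Poly_Mapping.lookup u e) := a))
    = (\<lambda>i. net_out u f i + int a * edge_div e i)"
proof
  fix i
  have "(\<Sum>x\<in>edge_copies u. int ((f((e, Poly_Mapping.lookup u e) := a)) x) * edge_div (fst x) i)
      = net_out u f i"
    unfolding net_out_def using new_copy_notin[of e u] by (intro sum.cong) auto
  then show "net_out (u + edge_monom e) (f((e, Poly_Mapping.lookup u e) := a)) i
      = net_out u f i + int a * edge_div e i"
    unfolding net_out_def by (simp only: edge_copies_add) (simp add: new_copy_notin)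
qed

text \<open>
  Weighting the vertex \<open>i\<close> by \<open>n - i\<close> makes every edge contribute at least its flow, which bounds
  the total flow by \<open>n\<close> times the supply.
\<close>

lemma flow_le_inflow:
  assumes "admissible n u"
  shows "(\<Sum>x\<in>edge_copies u. f x) \<le> n * inflow n (net_out u f)"
proof -
  have e: "(\<Sum>i=1..n. (int n - int i) * edge_div (fst x) i) \<ge> 1" if "x \<in> edge_copies u" for x
  proof -
    note a = admissible_copy[OF assms that]
    have "(\<Sum>i=1..n. (int n - int i) * edge_div (fst x) i)
        = (\<Sum>i=1..n. (int n - int i) * of_bool (i = fst (fst x)))
        - (\<Sum>i=1..n. (int n - int i) * of_bool (i = snd (fst x)))"
      by (simp add: edge_div_def right_diff_distrib sum_subtractf)
    also have "\<dots> = int (snd (fst x)) - int (fst (fst x))"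
      using a by (simp add: of_bool_def if_distrib cong: if_cong)
    finally show ?thesis using a by simp
  qed
  have "int (\<Sum>x\<in>edge_copies u. f x) = (\<Sum>x\<in>edge_copies u. int (f x) * 1)"
    by simp
  also have "\<dots> \<le> (\<Sum>x\<in>edge_copies u. int (f x) * (\<Sum>i=1..n. (int n - int i) * edge_div (fst x) i))"
    using e by (intro sum_mono mult_left_mono) auto
  also have "\<dots> = (\<Sum>i=1..n. (int n - int i) * net_out u f i)"
    unfolding net_out_def sum_distrib_left by (subst sum.swap) (simp add: mult_ac)
  also have "\<dots> \<le> (\<Sum>i=1..n. int n * int (nat (net_out u f i)))"
  proof (rule sum_mono)
    fix i assume i: "i \<in> {1..n}"
    have "(int n - int i) * net_out u f i \<le> (int n - int i) * int (nat (net_out u f i))"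
      using i by (intro mult_left_mono) auto
    also have "\<dots> \<le> int n * int (nat (net_out u f i))"
      by (intro mult_right_mono) auto
    finally show "(int n - int i) * net_out u f i \<le> int n * int (nat (net_out u f i))" .
  qed
  also have "\<dots> = int (n * inflow n (net_out u f))"
    by (simp add: inflow_def sum_distrib_left)
  finally show ?thesis by (simp only: of_nat_le_iff)
qed

lemma fin_levels_flows:
  assumes "admissible n u"
  shows "fin_levels (supported (edge_copies u)) (\<lambda>f. inflow n (net_out u f))"
  unfolding fin_levels_def
proof
  fix m
  show "finite {f \<in> supported (edge_copies u). inflow n (net_out u f) = m}"
    by (rule finite_subset[OF _ finite_supported_bounded[of "edge_copies u" "n * m"]])
      (use flow_le_inflow[OF assms] in auto)
qed

section \<open>The reduction relation for flows\<close>

lemma bij_betw_flows_add: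
  "bij_betw (\<lambda>(f, a). f((e, Poly_Mapping.lookup u e) := a))
    (supported (edge_copies u) \<times> UNIV) (supported (edge_copies (u + edge_monom e)))"
  unfolding edge_copies_add by (rule bij_betw_supported_insert[OF new_copy_notin])

lemma flow_gf_add:
  "flow_gf n (u + edge_monom e)
    = gen_fun (supported (edge_copies u) \<times> UNIV)
        (\<lambda>(f, a). inflow n (\<lambda>i. net_out u f i + int a * edge_div e i))"
  unfolding flow_gf_def
  by (rule gen_fun_bij[OF bij_betw_flows_add, symmetric]) (auto simp: net_out_upd)

text \<open>The number of the copy of \<open>e\<close> is taken after \<open>d\<close> has been
  added, which keeps the two new copies distinct even for \<open>d = e\<close>.\<close>

definition add_two :: "xmonom \<Rightarrow> nat \<times> nat \<Rightarrow> nat \<times> nat \<Rightarrow>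
    ((nat \<times> nat) \<times> nat \<Rightarrow> nat) \<times> nat \<times> nat \<Rightarrow> (nat \<times> nat) \<times> nat \<Rightarrow> nat" where
  "add_two u d e = (\<lambda>(f, a, b). (f((d, Poly_Mapping.lookup u d) := a))
     ((e, Poly_Mapping.lookup (u + edge_monom d) e) := b))"

definition inflow_two :: "nat \<Rightarrow> xmonom \<Rightarrow> nat \<times> nat \<Rightarrow> nat \<times> nat \<Rightarrow>
    ((nat \<times> nat) \<times> nat \<Rightarrow> nat) \<times> nat \<times> nat \<Rightarrow> nat" where
  "inflow_two n u d e = (\<lambda>(f, a, b).
     inflow n (\<lambda>i. net_out u f i + int a * edge_div d i + int b * edge_div e i))"

lemma bij_betw_flows_add_two:
  "bij_betw (add_two u d e) (supported (edge_copies u) \<times> UNIV \<times> UNIV)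
    (supported (edge_copies (u + edge_monom d + edge_monom e)))"
proof -
  have assoc: "bij_betw (\<lambda>(f, a, b). ((f, a), b))
      (supported (edge_copies u) \<times> UNIV \<times> UNIV) ((supported (edge_copies u) \<times> UNIV) \<times> UNIV)"
    by (rule bij_betw_byWitness[where f' = "\<lambda>((f, a), b). (f, a, b)"]) auto
  have first: "bij_betw (map_prod (\<lambda>(f, a). f((d, Poly_Mapping.lookup u d) := a)) id)
      ((supported (edge_copies u) \<times> UNIV) \<times> UNIV)
      (supported (edge_copies (u + edge_monom d)) \<times> UNIV)"
    by (rule bij_betw_map_prod[OF bij_betw_flows_add]) simp
  show ?thesis
    using bij_betw_trans[OF assoc bij_betw_trans[OF first bij_betw_flows_add[of e]]]
    by (rule bij_betw_cong[THEN iffD1, rotated]) (auto simp: add_two_def)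
qed

lemma inflow_add_two:
  "inflow n (net_out (u + edge_monom d + edge_monom e) (add_two u d e z))
    = inflow_two n u d e z"
  by (auto simp: add_two_def inflow_two_def net_out_upd split: prod.splits)

lemma flow_gf_add_two:
  "flow_gf n (u + edge_monom d + edge_monom e)
    = gen_fun (supported (edge_copies u) \<times> UNIV \<times> UNIV) (inflow_two n u d e)"
  unfolding flow_gf_def
  by (rule gen_fun_bij[OF bij_betw_flows_add_two, symmetric]) (simp add: inflow_add_two)

text \<open>Let \<open>a\<close> and \<open>b\<close> be the flows on \<open>(i, j)\<close> and
  \<open>(j, k)\<close>. If \<open>b \<le> a\<close>, move \<open>b\<close> to \<open>(i, k)\<close>
  and leave \<open>a - b\<close> on \<open>(i, j)\<close>; the case \<open>a \<le> b\<close> is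
  symmetric. On the overlap \<open>a = b\<close>, everything moves to \<open>(i, k)\<close>.\<close>

lemma flow_gf_reduce:
  assumes "admissible n u" "1 \<le> i" "i < j" "j < k" "k \<le> n"
  shows "flow_gf n (u + edge_monom (i, j) + edge_monom (j, k))
      + flow_gf n (u + edge_monom (i, k))
    = flow_gf n (u + edge_monom (i, k) + edge_monom (i, j))
      + flow_gf n (u + edge_monom (j, k) + edge_monom (i, k))"
proof -
  let ?F = "supported (edge_copies u)"
  let ?w = "inflow_two n u (i, j) (j, k)"
  define A where "A = {(f, a, b). f \<in> ?F \<and> (b :: nat) \<le> a}"
  define B where "B = {(f, a, b). f \<in> ?F \<and> (a :: nat) \<le> b}"
  have UN: "A \<union> B = ?F \<times> UNIV \<times> UNIV"
    by (auto simp: A_def B_def)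
  have "admissible n (u + edge_monom (i, j) + edge_monom (j, k))"
    using assms by (simp add: admissible_add)
  then have "fin_levels (A \<union> B) ?w"
    unfolding UN using fin_levels_flows
      fin_levels_bij[OF bij_betw_flows_add_two[of u "(i, j)" "(j, k)"], where w = ?w and
        v = "\<lambda>f. inflow n (net_out (u + edge_monom (i, j) + edge_monom (j, k)) f)"]
    by (simp add: inflow_add_two)
  then have "gen_fun A ?w + gen_fun B ?w = gen_fun (A \<union> B) ?w + gen_fun (A \<inter> B) ?w"
    by (rule gen_fun_Un_Int)
  moreover have "gen_fun (A \<union> B) ?w
      = flow_gf n (u + edge_monom (i, j) + edge_monom (j, k))"
    by (simp only: UN flow_gf_add_two)
  \<comment> \<open>Rerouting changes no divergence, hence no supply: the boundary of
    \<open>(i, k)\<close> is the sum of the other two.\<close>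
  moreover have split: "edge_div (i, k) l = edge_div (i, j) l + edge_div (j, k) l" for l
    by (simp add: edge_div_def)
  have "gen_fun A ?w = gen_fun (?F \<times> UNIV \<times> UNIV) (inflow_two n u (i, k) (i, j))"
  proof (rule gen_fun_bij[where h = "\<lambda>(f, a, b). (f, b, a - b)"])
    show "bij_betw (\<lambda>(f, a, b). (f, b, a - b)) A (?F \<times> UNIV \<times> UNIV)"
      by (rule bij_betw_byWitness[where f' = "\<lambda>(f, c, a). (f, a + c, c)"]) (auto simp: A_def)
  qed (auto simp: A_def inflow_two_def split algebra_simps of_nat_diff)
  moreover have "gen_fun B ?w = gen_fun (?F \<times> UNIV \<times> UNIV) (inflow_two n u (j, k) (i, k))"
  proof (rule gen_fun_bij[where h = "\<lambda>(f, a, b). (f, b - a, a)"])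
    show "bij_betw (\<lambda>(f, a, b). (f, b - a, a)) B (?F \<times> UNIV \<times> UNIV)"
      by (rule bij_betw_byWitness[where f' = "\<lambda>(f, b, c). (f, c, b + c)"]) (auto simp: B_def)
  qed (auto simp: B_def inflow_two_def split algebra_simps of_nat_diff)
  moreover have "gen_fun (A \<inter> B) ?w
      = gen_fun (?F \<times> UNIV) (\<lambda>(f, a). inflow n (\<lambda>l. net_out u f l + int a * edge_div (i, k) l))"
  proof (rule gen_fun_bij[where h = "\<lambda>(f, a, b). (f, a)"])
    show "bij_betw (\<lambda>(f, a, b). (f, a)) (A \<inter> B) (?F \<times> UNIV)"
      by (rule bij_betw_byWitness[where f' = "\<lambda>(f, a). (f, a, a)"]) (auto simp: A_def B_def)
  qed (auto simp: A_def B_def inflow_two_def split algebra_simps)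
  ultimately show ?thesis
    by (simp only: flow_gf_add_two flow_gf_add[of n u "(i, k)"])
qed

text \<open>The overlap term has one edge fewer than the others, so normalising turns its sign -1
  into \<open>-(1 - fps_X)\<close>, which is the value of beta.\<close>

lemma hstar_reduce:
  assumes "admissible n u" "1 \<le> i" "i < j" "j < k" "k \<le> n"
  shows "hstar n (u + edge_monom (i, j) + edge_monom (j, k))
    = hstar n (u + edge_monom (i, k) + edge_monom (i, j))
      + hstar n (u + edge_monom (j, k) + edge_monom (i, k))
      + (fps_X - 1) * hstar n (u + edge_monom (i, k))"
proof -
  have "flow_gf n (u + edge_monom (i, j) + edge_monom (j, k))
    = flow_gf n (u + edge_monom (i, k) + edge_monom (i, j))
      + flow_gf n (u + edge_monom (j, k) + edge_monom (i, k))
      - flow_gf n (u + edge_monom (i, k))"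
    using flow_gf_reduce[OF assms] by (simp add: algebra_simps)
  then show ?thesis
    unfolding hstar_def card_edge_copies_add by (simp only: power_Suc) (simp add: algebra_simps)
qed

text \<open>
  On a reduced graph every vertex has only outgoing or only incoming edges, so that the supply of
  a flow is its total.
\<close>

lemma hstar_reduced:
  assumes adm: "admissible n u"
    and red: "\<not> (\<exists>i j k. i < j \<and> j < k \<and> Poly_Mapping.lookup u (i, j) > 0 \<and>
      Poly_Mapping.lookup u (j, k) > 0)"
  shows "hstar n u = 1"
proof -
  have "inflow n (net_out u f) = (\<Sum>x\<in>edge_copies u. f x)" for f
  proof -
    have pos: "nat (net_out u f i) = (\<Sum>x\<in>edge_copies u. f x * of_bool (i = fst (fst x)))" for i
    proof (cases "\<exists>x\<in>edge_copies u. i = fst (fst x)")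
      case True
      then obtain x where x: "x \<in> edge_copies u" "i = fst (fst x)" by auto
      have "i \<noteq> snd (fst y)" if "y \<in> edge_copies u" for y
      proof
        assume y: "i = snd (fst y)"
        have "fst (fst y) < i" "i < snd (fst x)"
          using admissible_copy(2)[OF adm that] admissible_copy(2)[OF adm x(1)] x(2) y by simp_all
        moreover have "Poly_Mapping.lookup u (fst (fst y), i) > 0"
            "Poly_Mapping.lookup u (i, snd (fst x)) > 0"
          using that x y by (auto simp: edge_copies_def)
        ultimately show False using red by blast
      qed
      then have "net_out u f i = int (\<Sum>x\<in>edge_copies u. f x * of_bool (i = fst (fst x)))"
        unfolding net_out_def of_nat_sum by (intro sum.cong) (auto simp: edge_div_def)
      then show ?thesis by (simp only: nat_int)
    next
      case False
      then have "net_out u f i = (\<Sum>x\<in>edge_copies u. - int (f x) * of_bool (i = snd (fst x)))"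
        unfolding net_out_def by (intro sum.cong) (auto simp: edge_div_def)
      also have "\<dots> \<le> 0" by (intro sum_nonpos) auto
      finally show ?thesis using False by auto
    qed
    have "inflow n (net_out u f)
        = (\<Sum>x\<in>edge_copies u. \<Sum>i=1..n. f x * of_bool (i = fst (fst x)))"
      unfolding inflow_def pos by (rule sum.swap)
    also have "\<dots> = (\<Sum>x\<in>edge_copies u. f x)"
    proof (rule sum.cong)
      fix x assume "x \<in> edge_copies u"
      then have "fst (fst x) \<in> {1..n}" using admissible_copy[OF adm, of x] by simp
      then show "(\<Sum>i=1..n. f x * of_bool (i = fst (fst x))) = f x"
        by (simp add: of_bool_def if_distrib cong: if_cong)
    qed simp
    finally show ?thesis .
  qed
  then show ?thesis
    using gen_fun_supported[of "edge_copies u"] by (simp add: hstar_def flow_gf_def mult.commute)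
qed

section \<open>Reductions of polynomials\<close>

text \<open>The substitution of \<open>fps_X - 1\<close> for beta, a ring homomorphism.\<close>

definition shift_coeff :: "int poly \<Rightarrow> int fps" where
  "shift_coeff c = fps_of_poly (pcompose c [:-1, 1:])"

definition hstar_poly :: "nat \<Rightarrow> xpoly \<Rightarrow> int fps" where
  "hstar_poly n p = (\<Sum>u\<in>Poly_Mapping.keys p. shift_coeff (Poly_Mapping.lookup p u) * hstar n u)"

definition admissible_poly :: "nat \<Rightarrow> xpoly \<Rightarrow> bool" where
  "admissible_poly n p \<longleftrightarrow> (\<forall>u\<in>Poly_Mapping.keys p. admissible n u)"

lemma shift_coeff_simps:
  "shift_coeff 0 = 0" "shift_coeff 1 = 1"
  "shift_coeff (c + d) = shift_coeff c + shift_coeff d"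
  "shift_coeff (- c) = - shift_coeff c"
  "shift_coeff (c * d) = shift_coeff c * shift_coeff d"
  "shift_coeff (Polynomial.monom 1 1) = fps_X - 1"
  by (simp_all add: shift_coeff_def pcompose_add pcompose_mult pcompose_uminus fps_of_poly_add
      fps_of_poly_mult fps_of_poly_uminus pcompose_1 monom_Suc monom_0 pcompose_pCons
      fps_of_poly_pCons)

lemma shift_coeff_sum: "shift_coeff (sum g S) = (\<Sum>x\<in>S. shift_coeff (g x))"
  by (induction S rule: infinite_finite_induct) (auto simp: shift_coeff_simps)

text \<open>Keys can disappear by cancellation, so polynomials are compared over a common finite set
  of monomials.\<close>

lemma hstar_poly_superset:
  assumes "finite S" "Poly_Mapping.keys p \<subseteq> S"
  shows "hstar_poly n p = (\<Sum>u\<in>S. shift_coeff (Poly_Mapping.lookup p u) * hstar n u)"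
  unfolding hstar_poly_def using assms
  by (intro sum.mono_neutral_left) (auto simp: in_keys_iff shift_coeff_simps)

lemma hstar_poly_add: "hstar_poly n (p + q) = hstar_poly n p + hstar_poly n q"
proof -
  let ?S = "Poly_Mapping.keys p \<union> Poly_Mapping.keys q"
  have "finite ?S" "Poly_Mapping.keys (p + q) \<subseteq> ?S"
    by (simp_all add: Poly_Mapping.keys_add)
  then show ?thesis
    by (simp add: hstar_poly_superset[of ?S] lookup_add shift_coeff_simps distrib_right
        sum.distrib)
qed

lemma hstar_poly_single: "hstar_poly n (Poly_Mapping.single u c) = shift_coeff c * hstar n u"
  by (simp add: hstar_poly_superset[of "{u}"])

lemma hstar_poly_minus_single:
  "hstar_poly n (p - Poly_Mapping.single u c) = hstar_poly n p - shift_coeff c * hstar n u"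
proof -
  have "p - Poly_Mapping.single u c = p + Poly_Mapping.single u (- c)"
    by (simp add: single_uminus)
  then show ?thesis
    by (simp only: hstar_poly_add hstar_poly_single shift_coeff_simps) simp
qed

lemma replacement_eq:
  "Poly_Mapping.single u c * (xvar i k * xvar i j + xvar j k * xvar i k + xbeta * xvar i k)
    = Poly_Mapping.single (u + edge_monom (i, k) + edge_monom (i, j)) c
    + Poly_Mapping.single (u + edge_monom (j, k) + edge_monom (i, k)) c
    + Poly_Mapping.single (u + edge_monom (i, k)) (c * Polynomial.monom 1 1)"
  by (simp add: xvar_def xbeta_def edge_monom_def distrib_left mult_single add.assoc)

lemma reduction_step_cases:
  assumes "reduction_step p q"
  obtains i j k u s c where "i < j" "j < k"
    "s = u + edge_monom (i, j) + edge_monom (j, k)"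
    "s \<in> Poly_Mapping.keys p"
    "q = p - Poly_Mapping.single s (Poly_Mapping.lookup p s)
       + (Poly_Mapping.single (u + edge_monom (i, k) + edge_monom (i, j)) c
        + Poly_Mapping.single (u + edge_monom (j, k) + edge_monom (i, k)) c
        + Poly_Mapping.single (u + edge_monom (i, k)) (c * Polynomial.monom 1 1))"
    "c = Poly_Mapping.lookup p s"
  using assms by cases (metis replacement_eq edge_monom_def)

text \<open>The whole coefficient of \<open>s\<close> is subtracted, so \<open>s\<close> can only
  survive as one of the new monomials.\<close>

lemma keys_reduction:
  assumes "q = p - Poly_Mapping.single s (Poly_Mapping.lookup p s)
    + (Poly_Mapping.single t1 c1 + Poly_Mapping.single t2 c2 + Poly_Mapping.single t3 c3)"
  shows "Poly_Mapping.keys q \<subseteq> (Poly_Mapping.keys p - {s}) \<union> {t1, t2, t3}"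
  unfolding assms
  by (auto simp: in_keys_iff lookup_add lookup_minus lookup_single when_def split: if_splits)

lemma admissible_step:
  assumes "reduction_step p q" "admissible_poly n p"
  shows "admissible_poly n q"
  using assms(1)
proof (cases rule: reduction_step_cases)
  case (1 i j k u s c)
  have "admissible n s" using 1 assms(2) by (simp add: admissible_poly_def)
  with 1 show ?thesis
    using keys_reduction[OF 1(5)] assms(2) by (auto simp: admissible_poly_def admissible_add)
qed

lemma hstar_poly_step:
  assumes "reduction_step p q" "admissible_poly n p"
  shows "hstar_poly n q = hstar_poly n p"
  using assms(1)
proof (cases rule: reduction_step_cases)
  case (1 i j k u s c)
  have "admissible n s" using 1 assms(2) by (simp add: admissible_poly_def)
  then have "admissible n u" "1 \<le> i" "k \<le> n"
    using 1 by (auto simp: admissible_add)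
  then have H: "hstar n s = hstar n (u + edge_monom (i, k) + edge_monom (i, j))
      + hstar n (u + edge_monom (j, k) + edge_monom (i, k))
      + (fps_X - 1) * hstar n (u + edge_monom (i, k))"
    unfolding 1(3) using 1 by (intro hstar_reduce) auto
  show ?thesis
    unfolding 1(5) 1(6)[symmetric] hstar_poly_add hstar_poly_minus_single hstar_poly_single
      shift_coeff_simps H
    by (simp only: algebra_simps)
qed

lemma reduction_steps_invariant:
  assumes "reduction_step\<^sup>*\<^sup>* p q" "admissible_poly n p"
  shows "admissible_poly n q \<and> hstar_poly n q = hstar_poly n p"
  using assms by (induction rule: rtranclp_induct) (auto simp: admissible_step hstar_poly_step)

lemma hstar_poly_reduced:
  assumes "fully_reduced p" "admissible_poly n p"
  shows "hstar_poly n p = shift_coeff (xeval (\<lambda>_. 1) p)"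
proof -
  have "hstar n u = 1" if "u \<in> Poly_Mapping.keys p" for u
    using that assms by (intro hstar_reduced) (auto simp: fully_reduced_def admissible_poly_def)
  then show ?thesis
    by (simp add: hstar_poly_def xeval_def shift_coeff_sum)
qed

section \<open>Termination of the replacement process\<close>

text \<open>
  Each new monomial has smaller weight than the one it replaces, and a step creates at most
  three of them; hence the base 4 below.
\<close>

definition weight :: "nat \<Rightarrow> xmonom \<Rightarrow> nat" where
  "weight n u = (\<Sum>x\<in>edge_copies u. n - (snd (fst x) - fst (fst x)))"

lemma weight_add:
  "weight n (u + edge_monom (i, j)) = weight n u + (n - (j - i))"
  using sum_edge_copies_add[of "\<lambda>e. n - (snd e - fst e)" u "(i, j)"] by (simp add: weight_def)

lemma weight_sum_step:
  assumes "reduction_step p q" "admissible_poly n p"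
  shows "(\<Sum>u\<in>Poly_Mapping.keys q. 4 ^ weight n u) < (\<Sum>u\<in>Poly_Mapping.keys p. (4 :: nat) ^ weight n u)"
  using assms(1)
proof (cases rule: reduction_step_cases)
  case (1 i j k u s c)
  let ?t1 = "u + edge_monom (i, k) + edge_monom (i, j)"
  let ?t2 = "u + edge_monom (j, k) + edge_monom (i, k)"
  let ?t3 = "u + edge_monom (i, k)"
  let ?g = "\<lambda>u. (4 :: nat) ^ weight n u"
  have "admissible n s" using 1 assms(2) by (simp add: admissible_poly_def)
  then have adm: "1 \<le> i" "k \<le> n"
    using 1 by (auto simp: admissible_add)
  obtain W where W: "weight n s = Suc W"
    "weight n ?t1 \<le> W" "weight n ?t2 \<le> W" "weight n ?t3 \<le> W"
  proof -
    \<comment> \<open>The edge \<open>(i, k)\<close> is longer than the two edges it stands in for,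
      and longer edges weigh less. The bounds on \<open>i\<close> and \<open>k\<close> keep the
      subtractions from being cut off at 0.\<close>
    have "n - (k - i) < n - (j - i)" "n - (k - i) < n - (k - j)"
      using 1(1,2) adm by auto
    then show ?thesis
      by (intro that[of "weight n s - 1"]; unfold 1(3) weight_add; linarith)
  qed
  have le: "?g ?t1 \<le> 4 ^ W" "?g ?t2 \<le> 4 ^ W" "?g ?t3 \<le> 4 ^ W"
    using W(2-4) by (auto intro: power_increasing)
  have "(\<Sum>u\<in>Poly_Mapping.keys q. ?g u)
      \<le> (\<Sum>u\<in>(Poly_Mapping.keys p - {s}) \<union> {?t1, ?t2, ?t3}. ?g u)"
    using keys_reduction[OF 1(5)] by (intro sum_mono2) auto
  also have "\<dots> \<le> (\<Sum>u\<in>Poly_Mapping.keys p - {s}. ?g u) + (\<Sum>u\<in>{?t1, ?t2, ?t3}. ?g u)"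
    using sum.union_inter[of "Poly_Mapping.keys p - {s}" "{?t1, ?t2, ?t3}" ?g] by simp
  finally have q: "(\<Sum>u\<in>Poly_Mapping.keys q. ?g u)
      \<le> (\<Sum>u\<in>Poly_Mapping.keys p - {s}. ?g u) + (\<Sum>u\<in>{?t1, ?t2, ?t3}. ?g u)" .
  have "(\<Sum>u\<in>{?t1, ?t2, ?t3}. ?g u) \<le> ?g ?t1 + ?g ?t2 + ?g ?t3"
    by (simp add: sum.insert_if)
  also have "\<dots> < ?g s"
    using le zero_less_power[of "4::nat" W] unfolding W(1) power_Suc by linarith
  finally have "(\<Sum>u\<in>{?t1, ?t2, ?t3}. ?g u) < ?g s" .
  moreover have "(\<Sum>u\<in>Poly_Mapping.keys p. ?g u) = ?g s + (\<Sum>u\<in>Poly_Mapping.keys p - {s}. ?g u)"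
    by (rule sum.remove[OF finite_keys 1(4)])
  ultimately show ?thesis
    using q by linarith
qed

text \<open>Guarantees that a claim about all reduced polynomials of an admissible polynomial is not
  vacuous.\<close>

lemma reduction_exists:
  assumes "admissible_poly n p"
  shows "\<exists>q. is_reduced_poly_of q p"
  using assms
proof (induction "\<Sum>u\<in>Poly_Mapping.keys p. (4 :: nat) ^ weight n u" arbitrary: p rule: less_induct)
  case less
  show ?case
  proof (cases "fully_reduced p")
    case True
    then show ?thesis by (auto simp: is_reduced_poly_of_def)
  next
    case False
    then obtain s i j k where s: "s \<in> Poly_Mapping.keys p" "i < j" "j < k"
      "Poly_Mapping.lookup s (i, j) > 0" "Poly_Mapping.lookup s (j, k) > 0"
      by (auto simp: fully_reduced_def)
    \<comment> \<open>Subtraction of exponents is truncated; nothing is lost, since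
      \<open>(i, j)\<close> and \<open>(j, k)\<close> are different variables and both occur in
      \<open>s\<close>.\<close>
    define u where "u = s - Poly_Mapping.single (i, j) 1 - Poly_Mapping.single (j, k) 1"
    have "s = u + Poly_Mapping.single (i, j) 1 + Poly_Mapping.single (j, k) 1"
      by (rule poly_mapping_eqI)
        (use s in \<open>auto simp: u_def lookup_add lookup_minus lookup_single when_def\<close>)
    then obtain q where q: "reduction_step p q"
      using reduction_step.intros[OF s(2,3) _ s(1) refl] by blast
    obtain r where "is_reduced_poly_of r q"
      using less(1)[OF weight_sum_step[OF q less(2)] admissible_step[OF q less(2)]] by blast
    then show ?thesis
      using q by (auto simp: is_reduced_poly_of_def intro: converse_rtranclp_into_rtranclp)
  qed
qed

section \<open>Flows on the complete graph and lattice points\<close>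

definition edges :: "nat \<Rightarrow> (nat \<times> nat) set" where
  "edges n = {(i, j). 1 \<le> i \<and> i < j \<and> j \<le> n}"

definition complete_monom :: "nat \<Rightarrow> xmonom" where
  "complete_monom n = (\<Sum>e\<in>edges n. edge_monom e)"

text \<open>\<open>g p q\<close> is the flow on the edge \<open>(p, q)\<close>. Only edges within
  \<open>{1..n}\<close> count, not those to the sink; likewise \<open>in_flow\<close> omits the
  source.\<close>

definition out_flow :: "nat \<Rightarrow> (nat \<Rightarrow> nat \<Rightarrow> nat) \<Rightarrow> nat \<Rightarrow> nat" where
  "out_flow n g i = (\<Sum>q\<in>{i<..n}. g i q)"

definition in_flow :: "(nat \<Rightarrow> nat \<Rightarrow> nat) \<Rightarrow> nat \<Rightarrow> nat" where
  "in_flow g i = (\<Sum>p\<in>{1..<i}. g p i)"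

lemma finite_edges [simp]: "finite (edges n)"
  by (rule finite_subset[of _ "{..n} \<times> {..n}"]) (auto simp: edges_def)

lemma card_edges: "card (edges n) = n choose 2"
proof (induction n)
  case 0
  have "edges 0 = {}" by (auto simp: edges_def)
  then show ?case by simp
next
  case (Suc n)
  have "edges (Suc n) = edges n \<union> (\<lambda>i. (i, Suc n)) ` {1..n}"
    by (auto simp: edges_def le_Suc_eq)
  moreover have "card \<dots> = card (edges n) + card ((\<lambda>i. (i, Suc n)) ` {1..n})"
    by (rule card_Un_disjoint) (simp, simp, auto simp: edges_def)
  ultimately show ?case
    using Suc by (simp add: card_image inj_on_def numeral_2_eq_2)
qed

lemma w0_eq: "w0 n = Poly_Mapping.single (complete_monom n) 1"
proof -
  have "(\<Prod>e\<in>S. xvar (fst e) (snd e)) = Poly_Mapping.single (\<Sum>e\<in>S. edge_monom e) 1"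
    if "finite S" for S
    using that by induction (auto simp: xvar_def edge_monom_def mult_single)
  moreover have "w0 n = (\<Prod>e\<in>edges n. xvar (fst e) (snd e))"
    by (simp add: w0_def edges_def case_prod_beta)
  ultimately show ?thesis
    by (simp add: complete_monom_def)
qed

lemma lookup_complete_monom: "Poly_Mapping.lookup (complete_monom n) v = of_bool (v \<in> edges n)"
  by (simp add: complete_monom_def edge_monom_def lookup_sum lookup_single when_def of_bool_def)

lemma edge_copies_complete: "edge_copies (complete_monom n) = (\<lambda>e. (e, 0)) ` edges n"
  by (auto simp: edge_copies_def lookup_complete_monom of_bool_def split: if_splits)

lemma card_edge_copies_complete: "card (edge_copies (complete_monom n)) = n choose 2"
  by (simp add: edge_copies_complete card_image inj_on_def card_edges)

lemma admissible_w0: "admissible_poly n (w0 n)"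
  by (auto simp: w0_eq admissible_poly_def admissible_def in_keys_iff lookup_complete_monom edges_def)

lemma net_out_complete:
  assumes "i \<in> {1..n}"
  shows "net_out (complete_monom n) f i
    = int (out_flow n (\<lambda>p q. f ((p, q), 0)) i) - int (in_flow (\<lambda>p q. f ((p, q), 0)) i)"
proof -
  have "net_out (complete_monom n) f i = (\<Sum>e\<in>edges n. int (f (e, 0)) * edge_div e i)"
    by (simp add: net_out_def edge_copies_complete sum.reindex inj_on_def)
  also have "\<dots> = (\<Sum>e\<in>edges n. if i = fst e then int (f (e, 0)) else 0)
      - (\<Sum>e\<in>edges n. if i = snd e then int (f (e, 0)) else 0)"
    unfolding sum_subtractf[symmetric] by (intro sum.cong) (auto simp: edge_div_def)
  also have "(\<Sum>e\<in>edges n. if i = fst e then int (f (e, 0)) else 0)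
      = (\<Sum>e | e \<in> edges n \<and> i = fst e. int (f (e, 0)))"
    by (rule sum.inter_filter[symmetric]) simp
  also have "\<dots> = int (out_flow n (\<lambda>p q. f ((p, q), 0)) i)"
    unfolding out_flow_def of_nat_sum
    by (rule sum.reindex_bij_witness[where i = "\<lambda>q. (i, q)" and j = snd])
      (use assms in \<open>auto simp: edges_def\<close>)
  also have "(\<Sum>e\<in>edges n. if i = snd e then int (f (e, 0)) else 0)
      = (\<Sum>e | e \<in> edges n \<and> i = snd e. int (f (e, 0)))"
    by (rule sum.inter_filter[symmetric]) simp
  also have "\<dots> = int (in_flow (\<lambda>p q. f ((p, q), 0)) i)"
    unfolding in_flow_def of_nat_sum
    by (rule sum.reindex_bij_witness[where i = "\<lambda>p. (p, i)" and j = fst])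
      (use assms in \<open>auto simp: edges_def\<close>)
  finally show ?thesis .
qed

text \<open>Edges inside \<open>{1..<j}\<close> cancel and no edge leads back across the cut, so the
  net outflow is exactly what crosses to \<open>{j..n}\<close>.\<close>

lemma cut_flow:
  assumes "1 \<le> j" "j \<le> Suc n"
  shows "(\<Sum>i\<in>{1..<j}. int (out_flow n g i) - int (in_flow g i))
    = (\<Sum>i\<in>{1..<j}. \<Sum>q\<in>{j..n}. int (g i q))"
  using assms
proof (induction j rule: dec_induct)
  case base
  then show ?case by simp
next
  case (step j)
  have "(\<Sum>q\<in>{j..n}. int (g i q)) = int (g i j) + (\<Sum>q\<in>{Suc j..n}. int (g i q))" for i
    using step by (simp add: sum.atLeast_Suc_atMost)
  moreover have "{j<..n} = {Suc j..n}" by auto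
  ultimately show ?case
    using step by (simp add: sum.distrib out_flow_def in_flow_def)
qed

section \<open>Lattice points of the dilated polytope\<close>

definition cry_points :: "nat \<Rightarrow> nat \<Rightarrow> (nat \<Rightarrow> nat \<Rightarrow> nat) set" where
  "cry_points n m = {a. (\<forall>i j. n < i \<or> n < j \<or> i + 1 < j \<longrightarrow> a i j = 0) \<and>
     (\<forall>j\<le>n. (\<Sum>i\<le>n. a i j) = m) \<and> (\<forall>i\<le>n. (\<Sum>j\<le>n. a i j) = m)}"

text \<open>Integral points of the dilate have entries in the natural numbers; conversely, dividing
  by \<open>m\<close> returns to the polytope when \<open>m\<close> is positive.\<close>

lemma ehrhart_count_CRY: "ehrhart_count (CRY (n + 1)) m = card (cry_points n m)"
proof -
  let ?h = "\<lambda>a. mat (n + 1) (n + 1) (\<lambda>(i, j). real (a i j))"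
  have lt: "{..<n + 1} = {..n}" by auto
  have "inj_on ?h (cry_points n m)"
  proof (rule inj_onI)
    fix a b assume ab: "a \<in> cry_points n m" "b \<in> cry_points n m" "?h a = ?h b"
    show "a = b"
    proof (intro ext)
      fix i j
      show "a i j = b i j"
      proof (cases "i \<le> n \<and> j \<le> n")
        case True
        then have "?h a $$ (i, j) = real (a i j)" "?h b $$ (i, j) = real (b i j)" by simp_all
        then show ?thesis using ab(3) by simp
      qed (use ab in \<open>auto simp: cry_points_def\<close>)
    qed
  qed
  moreover have "{A \<in> (\<lambda>B. of_nat m \<cdot>\<^sub>m B) ` CRY (n + 1). elements_mat A \<subseteq> \<int>}
      = ?h ` cry_points n m"
  proof (intro equalityI subsetI)
    fix A assume "A \<in> {A \<in> (\<lambda>B. of_nat m \<cdot>\<^sub>m B) ` CRY (n + 1). elements_mat A \<subseteq> \<int>}"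
    then obtain B where A: "A = of_nat m \<cdot>\<^sub>m B" "elements_mat A \<subseteq> \<int>" and B: "B \<in> CRY (n + 1)"
      by auto
    have carr: "B \<in> carrier_mat (n + 1) (n + 1)" using B by (simp add: CRY_def)
    define a where "a i j = (if i \<le> n \<and> j \<le> n then nat \<lfloor>A $$ (i, j)\<rfloor> else 0)" for i j
    have AB: "A $$ (i, j) = real m * B $$ (i, j)" if "i \<le> n" "j \<le> n" for i j
      using A carr that by simp
    have a: "real (a i j) = real m * B $$ (i, j)" if "i \<le> n" "j \<le> n" for i j
    proof -
      have "A $$ (i, j) \<in> \<int>"
        using A(1) carr that
        by (intro subsetD[OF A(2) elements_matI[of A "n + 1" "n + 1" i j]]) auto
      moreover have "A $$ (i, j) \<ge> 0"
        using B that AB by (simp add: CRY_def)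
      ultimately show ?thesis
        using that AB[OF that] by (auto simp: a_def elim!: Ints_cases)
    qed
    have "real (\<Sum>i\<le>n. a i j) = real m" if "j \<le> n" for j
    proof -
      have "real (\<Sum>i\<le>n. a i j) = real m * (\<Sum>i<n + 1. B $$ (i, j))"
        unfolding lt of_nat_sum sum_distrib_left using a that by (intro sum.cong) auto
      then show ?thesis using B that by (simp add: CRY_def)
    qed
    moreover have "real (\<Sum>j\<le>n. a i j) = real m" if "i \<le> n" for i
    proof -
      have "real (\<Sum>j\<le>n. a i j) = real m * (\<Sum>j<n + 1. B $$ (i, j))"
        unfolding lt of_nat_sum sum_distrib_left using a that by (intro sum.cong) auto
      then show ?thesis using B that by (simp add: CRY_def)
    qed
    moreover have "a i j = 0" if "n < i \<or> n < j \<or> i + 1 < j" for i j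
    proof (cases "i \<le> n \<and> j \<le> n")
      case True
      then have "B $$ (i, j) = 0" using B that by (auto simp: CRY_def)
      then show ?thesis using a[of i j] True by simp
    qed (auto simp: a_def)
    ultimately have "a \<in> cry_points n m"
      unfolding cry_points_def of_nat_eq_iff by blast
    moreover have "A = ?h a"
      by (rule eq_matI) (use A carr a in auto)
    ultimately show "A \<in> ?h ` cry_points n m" by blast
  next
    fix A assume "A \<in> ?h ` cry_points n m"
    then obtain a where a: "a \<in> cry_points n m" and A: "A = ?h a" by auto
    have "A \<in> (\<lambda>B. of_nat m \<cdot>\<^sub>m B) ` CRY (n + 1)"
    \<comment> \<open>For \<open>m = 0\<close> only the zero matrix is left and division by
      \<open>m\<close> fails; the identity matrix serves as its preimage.\<close>
    proof (cases "m = 0")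
      case True
      have "a i j = 0" if "i \<le> n" "j \<le> n" for i j
      proof -
        have "(\<Sum>i\<le>n. a i j) = 0" using a that True by (simp add: cry_points_def)
        then show ?thesis using that by simp
      qed
      then have "A = of_nat m \<cdot>\<^sub>m 1\<^sub>m (n + 1)"
        unfolding A by (intro eq_matI) (auto simp: True)
      moreover have "1\<^sub>m (n + 1) \<in> CRY (n + 1)"
        by (auto simp: CRY_def if_distrib cong: if_cong)
      ultimately show ?thesis by blast
    next
      case False
      let ?B = "mat (n + 1) (n + 1) (\<lambda>(i, j). real (a i j) / real m)"
      have "(\<Sum>i<n + 1. ?B $$ (i, j)) = 1" if "j < n + 1" for j
      proof -
        have "(\<Sum>i<n + 1. ?B $$ (i, j)) = real (\<Sum>i\<le>n. a i j) / real m"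
          unfolding lt of_nat_sum sum_divide_distrib using that by (intro sum.cong) auto
        also have "(\<Sum>i\<le>n. a i j) = m" using a that by (simp add: cry_points_def)
        finally show ?thesis using False by simp
      qed
      moreover have "(\<Sum>j<n + 1. ?B $$ (i, j)) = 1" if "i < n + 1" for i
      proof -
        have "(\<Sum>j<n + 1. ?B $$ (i, j)) = real (\<Sum>j\<le>n. a i j) / real m"
          unfolding lt of_nat_sum sum_divide_distrib using that by (intro sum.cong) auto
        also have "(\<Sum>j\<le>n. a i j) = m" using a that by (simp add: cry_points_def)
        finally show ?thesis using False by simp
      qed
      moreover have "?B $$ (i, j) = 0" if "i < n + 1" "j < n + 1" "j > i + 1" for i j
        using a that by (simp add: cry_points_def)
      ultimately have "?B \<in> CRY (n + 1)"
        unfolding CRY_def by auto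
      moreover have "A = of_nat m \<cdot>\<^sub>m ?B"
        unfolding A by (intro eq_matI) (auto simp: False)
      ultimately show ?thesis by blast
    qed
    moreover have "elements_mat A \<subseteq> \<int>"
      unfolding A by (auto simp: elements_mat_def)
    ultimately show "A \<in> {A \<in> (\<lambda>B. of_nat m \<cdot>\<^sub>m B) ` CRY (n + 1). elements_mat A \<subseteq> \<int>}"
      by blast
  qed
  ultimately show ?thesis
    unfolding ehrhart_count_def by (simp add: card_image)
qed

section \<open>Bijection between lattice points and flows with slack\<close>

text \<open>
  Entry \<open>(q - 1, p)\<close> of the matrix, \<open>p < q\<close>, is the flow on the edge \<open>(p, q)\<close> of the complete graph
  on \<open>{0..n + 1}\<close> with source \<open>0\<close> and sink \<open>n + 1\<close>, and entry \<open>(p - 1, p)\<close> is the unused capacity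
  \<open>m - out p\<close> of the vertex \<open>p\<close>.  At a vertex \<open>i\<close>, \<open>r i\<close> is the common part of the flows
  on \<open>(0, i)\<close> and \<open>(i, n + 1)\<close>; \<open>r 0\<close> is the flow on \<open>(0, n + 1)\<close>.
\<close>

definition flow_of_point ::
    "nat \<Rightarrow> (nat \<Rightarrow> nat \<Rightarrow> nat) \<Rightarrow> ((nat \<times> nat) \<times> nat \<Rightarrow> nat) \<times> (nat \<Rightarrow> nat)" where
  "flow_of_point n a =
     ((\<lambda>((p, q), c). if c = 0 \<and> 1 \<le> p \<and> p < q \<and> q \<le> n then a (q - 1) p else 0),
      (\<lambda>i. if i = 0 then a n 0 else if i \<le> n then min (a (i - 1) 0) (a n i) else 0))"

definition point_of_flow ::
    "nat \<Rightarrow> nat \<Rightarrow> ((nat \<times> nat) \<times> nat \<Rightarrow> nat) \<times> (nat \<Rightarrow> nat) \<Rightarrow> nat \<Rightarrow> nat \<Rightarrow> nat" where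
  "point_of_flow n m = (\<lambda>(f, r) i j.
     let d = net_out (complete_monom n) f in
     if n < i \<or> n < j \<or> i + 1 < j then 0
     else if j = 0 then (if i = n then r 0 else nat (d (i + 1)) + r (i + 1))
     else if i = n then nat (- d j) + r j
     else if j \<le> i then f ((j, i + 1), 0)
     else m - (out_flow n (\<lambda>p q. f ((p, q), 0)) j + nat (- d j) + r j))"

text \<open>The index set \<open>{0..n}\<close> of the second component supplies the
  \<open>n + 1\<close> free parameters: one per vertex, and 0 for the source-sink edge.\<close>

definition slack_flows :: "nat \<Rightarrow> (((nat \<times> nat) \<times> nat \<Rightarrow> nat) \<times> (nat \<Rightarrow> nat)) set" where
  "slack_flows n = supported (edge_copies (complete_monom n)) \<times> supported {0..n}"

definition slack_value :: "nat \<Rightarrow> ((nat \<times> nat) \<times> nat \<Rightarrow> nat) \<times> (nat \<Rightarrow> nat) \<Rightarrow> nat" where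
  "slack_value n = (\<lambda>(f, r). inflow n (net_out (complete_monom n) f) + sum r {0..n})"

lemma column_sum_split:
  assumes "\<And>i j. i + 1 < j \<Longrightarrow> a i j = 0" "1 \<le> j" "j \<le> n"
  shows "(\<Sum>i\<le>n. a i j) = a (j - 1) j + out_flow n (\<lambda>p q. a (q - 1) p) j + a n j"
proof -
  have "(\<Sum>i\<le>n. a i j) = (\<Sum>i\<in>{j - 1..n}. a i j)"
    by (rule sum.mono_neutral_right) (use assms in auto)
  also have "{j - 1..n} = insert (j - 1) (insert n {j..<n})"
    using assms by auto
  also have "(\<Sum>i\<in>\<dots>. a i j) = a (j - 1) j + (\<Sum>i\<in>{j..<n}. a i j) + a n j"
    using assms by (subst sum.insert) auto
  also have "(\<Sum>i\<in>{j..<n}. a i j) = out_flow n (\<lambda>p q. a (q - 1) p) j"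
    unfolding out_flow_def
    by (rule sum.reindex_bij_witness[where i = "\<lambda>q. q - 1" and j = Suc]) auto
  finally show ?thesis .
qed

lemma row_sum_split:
  assumes "\<And>i j. i + 1 < j \<Longrightarrow> a i j = 0" "1 \<le> i" "i \<le> n"
  shows "(\<Sum>j\<le>n. a (i - 1) j) = a (i - 1) 0 + in_flow (\<lambda>p q. a (q - 1) p) i + a (i - 1) i"
proof -
  have "(\<Sum>j\<le>n. a (i - 1) j) = (\<Sum>j\<in>{..i}. a (i - 1) j)"
    by (rule sum.mono_neutral_right) (use assms in auto)
  also have "{..i} = insert 0 (insert i {1..<i})"
    using assms by auto
  also have "(\<Sum>j\<in>\<dots>. a (i - 1) j) = a (i - 1) 0 + (\<Sum>j\<in>{1..<i}. a (i - 1) j) + a (i - 1) i"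
    using assms by (subst sum.insert) auto
  finally show ?thesis by (simp add: in_flow_def)
qed

text \<open>Column \<open>i\<close> and row \<open>i - 1\<close> both sum to \<open>m\<close> and
  share the capacity entry \<open>a (i - 1) i\<close>; subtracting them gives flow conservation at
  \<open>i\<close>.\<close>

lemma flow_of_point_net_out:
  assumes a: "a \<in> cry_points n m" and i: "i \<in> {1..n}"
  shows "net_out (complete_monom n) (fst (flow_of_point n a)) i = int (a (i - 1) 0) - int (a n i)"
    and "out_flow n (\<lambda>p q. fst (flow_of_point n a) ((p, q), 0)) i + a n i + a (i - 1) i = m"
proof -
  let ?f = "fst (flow_of_point n a)"
  have z: "\<And>i j. i + 1 < j \<Longrightarrow> a i j = 0" using a by (simp add: cry_points_def)
  have o: "out_flow n (\<lambda>p q. ?f ((p, q), 0)) i = out_flow n (\<lambda>p q. a (q - 1) p) i"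
    using i by (auto simp: out_flow_def flow_of_point_def intro!: sum.cong)
  have n: "in_flow (\<lambda>p q. ?f ((p, q), 0)) i = in_flow (\<lambda>p q. a (q - 1) p) i"
    using i by (auto simp: in_flow_def flow_of_point_def intro!: sum.cong)
  have c: "a (i - 1) i + out_flow n (\<lambda>p q. a (q - 1) p) i + a n i = m"
    using column_sum_split[of a i n] z a i by (simp add: cry_points_def)
  have r: "a (i - 1) 0 + in_flow (\<lambda>p q. a (q - 1) p) i + a (i - 1) i = m"
    using row_sum_split[of a i n] z a i diff_le_self[of i 1, THEN le_trans, of n] by (simp add: cry_points_def)
  show "net_out (complete_monom n) ?f i = int (a (i - 1) 0) - int (a n i)"
    unfolding net_out_complete[OF i] o n using c r by linarith
  show "out_flow n (\<lambda>p q. ?f ((p, q), 0)) i + a n i + a (i - 1) i = m"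
    unfolding o using c by linarith
qed

lemma flow_of_point_mem:
  assumes a: "a \<in> cry_points n m"
  shows "flow_of_point n a \<in> slack_flows n" "slack_value n (flow_of_point n a) = m"
proof -
  show "flow_of_point n a \<in> slack_flows n"
    by (auto simp: slack_flows_def flow_of_point_def supported_def edge_copies_complete edges_def)
  let ?d = "net_out (complete_monom n) (fst (flow_of_point n a))"
  \<comment> \<open>The positive part of \<open>x - y\<close> plus \<open>min x y\<close> is
    \<open>x\<close>. Summing over the vertices then yields the sum of column 0.\<close>
  have "nat (?d i) + snd (flow_of_point n a) i = a (i - 1) 0" if "i \<in> {1..n}" for i
    using that by (simp add: flow_of_point_net_out[OF a that]) (auto simp: flow_of_point_def)
  then have "(\<Sum>i=1..n. nat (?d i)) + (\<Sum>i=1..n. snd (flow_of_point n a) i)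
      = (\<Sum>i=1..n. a (i - 1) 0)"
    unfolding sum.distrib[symmetric] by (intro sum.cong) auto
  also have "\<dots> = (\<Sum>i<n. a i 0)"
    by (rule sum.reindex_bij_witness[where i = Suc and j = "\<lambda>i. i - 1"]) auto
  finally have "(\<Sum>i=1..n. nat (?d i)) + (\<Sum>i=1..n. snd (flow_of_point n a) i) + a n 0
      = (\<Sum>i\<le>n. a i 0)"
    by (simp add: lessThan_Suc_atMost[symmetric])
  also have "\<dots> = m" using a by (simp add: cry_points_def)
  finally show "slack_value n (flow_of_point n a) = m"
    by (simp add: slack_value_def inflow_def case_prod_beta sum.atLeast_Suc_atMost[of 0])
      (simp add: flow_of_point_def)
qed

lemma point_of_flow_of_point:
  assumes a: "a \<in> cry_points n m"
  shows "point_of_flow n m (flow_of_point n a) = a"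
proof (intro ext)
  fix i j
  have z: "\<And>i j. n < i \<or> n < j \<or> i + 1 < j \<Longrightarrow> a i j = 0"
    using a unfolding cry_points_def by blast
  show "point_of_flow n m (flow_of_point n a) i j = a i j"
  proof (cases "n < i \<or> n < j \<or> i + 1 < j")
    case True
    then show ?thesis using z by (simp add: point_of_flow_def case_prod_beta)
  next
    case F: False
    note fp = flow_of_point_net_out[OF a]
    \<comment> \<open>The positions are the corner, the rest of column 0, the rest of the last row,
      the flow entries, and the superdiagonal.\<close>
    consider "j = 0" "i = n" | "j = 0" "i < n" | "1 \<le> j" "i = n" | "1 \<le> j" "j \<le> i" "i < n"
      | "1 \<le> j" "j = i + 1" "i < n"
      using F by linarith
    then show ?thesis
    proof cases
      case 1
      then show ?thesis by (simp add: point_of_flow_def case_prod_beta flow_of_point_def)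
    next
      case 2
      then show ?thesis using fp(1)[of "i + 1"]
        by (simp add: point_of_flow_def case_prod_beta) (simp add: flow_of_point_def)
    next
      case 3
      then show ?thesis using fp(1)[of j] F
        by (simp add: point_of_flow_def case_prod_beta) (simp add: flow_of_point_def)
    next
      case 4
      then show ?thesis using F
        by (simp add: point_of_flow_def case_prod_beta) (simp add: flow_of_point_def)
    next
      case 5
      have "nat (- net_out (complete_monom n) (fst (flow_of_point n a)) j)
          + snd (flow_of_point n a) j = a n j"
        using fp(1)[of j] 5 by (simp add: flow_of_point_def)
      then show ?thesis using fp(2)[of j] F 5
        by (simp add: point_of_flow_def case_prod_beta)
    qed
  qed
qed

lemma flow_of_point_of_flow:
  assumes "z \<in> slack_flows n"
  shows "flow_of_point n (point_of_flow n m z) = z"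
proof -
  obtain f r where z: "z = (f, r)" by force
  have f: "f ((p, q), c) = 0" if "\<not> (c = 0 \<and> 1 \<le> p \<and> p < q \<and> q \<le> n)" for p q c
    using assms that
    by (auto simp: z slack_flows_def supported_def edge_copies_complete edges_def image_iff)
  have r: "r i = 0" if "n < i" for i
    using assms that by (auto simp: z slack_flows_def supported_def)
  have "fst (flow_of_point n (point_of_flow n m z)) x = f x" for x
    using f by (cases x rule: prod.exhaust[of _ thesis for thesis], cases "fst x")
      (auto simp: flow_of_point_def point_of_flow_def z Let_def)
  \<comment> \<open>Of the positive and negative parts of a divergence at least one is 0, so the
    minimum that defines the slack returns \<open>r i\<close>.\<close>
  moreover have "snd (flow_of_point n (point_of_flow n m z)) i = r i" for i
    using r[of i] by (auto simp: flow_of_point_def point_of_flow_def z Let_def)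
  ultimately show ?thesis
    by (simp add: z prod_eq_iff fun_eq_iff)
qed

lemma point_of_flow_mem:
  assumes m: "slack_value n z = m"
  shows "point_of_flow n m z \<in> cry_points n m"
proof -
  obtain f r where z: "z = (f, r)" by force
  define g where "g p q = f ((p, q), 0)" for p q
  define d where "d = net_out (complete_monom n) f"
  let ?a = "point_of_flow n m z"
  have d: "d i = int (out_flow n g i) - int (in_flow g i)" if "i \<in> {1..n}" for i
    using net_out_complete[OF that, of f] by (simp add: d_def g_def[abs_def])
  have cut: "(\<Sum>i\<in>{1..<j}. d i) = (\<Sum>i\<in>{1..<j}. \<Sum>q\<in>{j..n}. int (g i q))"
    if "1 \<le> j" "j \<le> Suc n" for j
    unfolding cut_flow[OF that, symmetric] using that by (intro sum.cong d) auto
  have m': "m = (\<Sum>i=1..n. nat (d i) + r i) + r 0"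
    using m by (simp add: z slack_value_def inflow_def d_def sum.distrib sum.atLeast_Suc_atMost[of 0])
  \<comment> \<open>This keeps the superdiagonal subtraction from being cut off at 0. What enters
    \<open>j\<close> crosses the cut before \<open>j\<close>, so it is at most the supply of the
    earlier vertices; adding the supply and slack at \<open>j\<close> stays within \<open>m\<close>.
    By conservation the result equals the left side.\<close>
  have cap: "out_flow n g j + nat (- d j) + r j \<le> m" if j: "j \<in> {1..n}" for j
  proof -
    have "int (in_flow g j) = (\<Sum>i\<in>{1..<j}. int (g i j))"
      by (simp add: in_flow_def)
    also have "\<dots> \<le> (\<Sum>i\<in>{1..<j}. \<Sum>q\<in>{j..n}. int (g i q))"
      using j by (intro sum_mono member_le_sum) auto
    also have "\<dots> = (\<Sum>i\<in>{1..<j}. d i)"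
      using cut j by simp
    also have "\<dots> \<le> (\<Sum>i\<in>{1..<j}. int (nat (d i) + r i))"
      by (intro sum_mono) auto
    also have "\<dots> = int (\<Sum>i\<in>{1..<j}. nat (d i) + r i)"
      by simp
    finally have "in_flow g j \<le> (\<Sum>i\<in>{1..<j}. nat (d i) + r i)"
      by (simp only: of_nat_le_iff)
    then have "in_flow g j + (nat (d j) + r j) \<le> (\<Sum>i\<in>insert j {1..<j}. nat (d i) + r i)"
      by simp
    also have "\<dots> \<le> (\<Sum>i=1..n. nat (d i) + r i)"
      using j by (intro sum_mono2) auto
    also have "\<dots> \<le> m" by (simp add: m')
    finally show ?thesis using d[OF j] by linarith
  qed
  have zero: "?a i j = 0" if "n < i \<or> n < j \<or> i + 1 < j" for i j
    using that by (simp add: point_of_flow_def z)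
  have corner: "?a n 0 = r 0"
    by (simp add: point_of_flow_def z)
  have first: "?a (j - 1) 0 = nat (d j) + r j"
    and last: "?a n j = nat (- d j) + r j"
    and super: "?a (j - 1) j = m - (out_flow n g j + nat (- d j) + r j)"
    if "j \<in> {1..n}" for j
    using that by (auto simp: point_of_flow_def z Let_def d_def g_def[abs_def])
  have out: "out_flow n (\<lambda>p q. ?a (q - 1) p) j = out_flow n g j" if "j \<in> {1..n}" for j
    using that by (auto simp: out_flow_def point_of_flow_def z g_def Let_def intro!: sum.cong)
  have inn: "in_flow (\<lambda>p q. ?a (q - 1) p) j = in_flow g j" if "j \<in> {1..n}" for j
    using that by (auto simp: in_flow_def point_of_flow_def z g_def Let_def intro!: sum.cong)
  have "(\<Sum>i\<le>n. ?a i j) = m" if "j \<le> n" for j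
  proof (cases "j = 0")
    case True
    have "(\<Sum>i\<le>n. ?a i 0) = (\<Sum>i<n. ?a i 0) + r 0"
      by (simp add: lessThan_Suc_atMost[symmetric] corner)
    also have "(\<Sum>i<n. ?a i 0) = (\<Sum>j=1..n. nat (d j) + r j)"
      by (rule sum.reindex_bij_witness[where j = Suc and i = "\<lambda>i. i - 1"])
        (use first[of "Suc _"] in auto)
    finally show ?thesis using True m' by simp
  next
    case False
    then have j: "j \<in> {1..n}" using that by simp
    have "(\<Sum>i\<le>n. ?a i j) = ?a (j - 1) j + out_flow n (\<lambda>p q. ?a (q - 1) p) j + ?a n j"
      by (rule column_sum_split) (use zero j in auto)
    then show ?thesis
      unfolding out[OF j] last[OF j] super[OF j] using cap[OF j] by simp
  qed
  moreover have "(\<Sum>j\<le>n. ?a i j) = m" if "i \<le> n" for i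
  proof (cases "i = n")
    case True
    \<comment> \<open>Nothing crosses the cut after the last vertex. Hence positive and negative
      parts have equal sums, and the last row has the same sum as column 0.\<close>
    have "(\<Sum>i\<in>{1..n}. d i) = 0"
      using cut[of "Suc n"] by (simp add: atLeastLessThanSuc_atLeastAtMost)
    moreover have "int (nat (- x)) = int (nat x) - x" for x
      by simp
    ultimately have "int (\<Sum>j=1..n. nat (- d j) + r j) = int (\<Sum>j=1..n. nat (d j) + r j)"
      by (simp only: of_nat_sum of_nat_add sum.distrib sum_subtractf)
    then have "(\<Sum>j=1..n. nat (- d j) + r j) = (\<Sum>j=1..n. nat (d j) + r j)"
      by (simp only: of_nat_eq_iff)
    moreover have "(\<Sum>j\<le>n. ?a n j) = r 0 + (\<Sum>j=1..n. nat (- d j) + r j)"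
      using last by (simp add: atMost_atLeast0 sum.atLeast_Suc_atMost[of 0] corner)
    ultimately show ?thesis using True m' by simp
  next
    case False
    then have i: "i + 1 \<in> {1..n}" using that by simp
    have "(\<Sum>j\<le>n. ?a (i + 1 - 1) j)
        = ?a (i + 1 - 1) 0 + in_flow (\<lambda>p q. ?a (q - 1) p) (i + 1) + ?a (i + 1 - 1) (i + 1)"
      by (rule row_sum_split) (use zero i in auto)
    then show ?thesis
      unfolding inn[OF i] first[OF i] super[OF i] using cap[OF i] d[OF i] by simp
  qed
  ultimately show ?thesis
    using zero by (simp add: cry_points_def)
qed

lemma card_cry_points: "card (cry_points n m) = card {z \<in> slack_flows n. slack_value n z = m}"
proof (rule bij_betw_same_card)
  show "bij_betw (flow_of_point n) (cry_points n m) {z \<in> slack_flows n. slack_value n z = m}"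
    by (rule bij_betw_byWitness[where f' = "point_of_flow n m"])
      (auto simp: flow_of_point_mem point_of_flow_of_point flow_of_point_of_flow point_of_flow_mem)
qed

text \<open>The exponent splits as \<open>(n choose 2) + (n + 1)\<close>: the first summand
  normalises the flows on the complete graph, the second cancels the series of the slack
  variables.\<close>

lemma ehrhart_series_CRY:
  "Abs_fps (\<lambda>m. int (ehrhart_count (CRY (n + 1)) m)) * (1 - fps_X) ^ ((n + 1 choose 2) + 1)
    = hstar n (complete_monom n)"
proof -
  have "Abs_fps (\<lambda>m. int (ehrhart_count (CRY (n + 1)) m)) = gen_fun (slack_flows n) (slack_value n)"
    by (simp add: gen_fun_def ehrhart_count_CRY card_cry_points del: One_nat_def)
  also have "\<dots> = flow_gf n (complete_monom n) * gen_fun (supported {0..n}) (\<lambda>r. sum r {0..n})"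
    unfolding slack_flows_def slack_value_def flow_gf_def
    using admissible_w0[of n]
    by (intro gen_fun_Times fin_levels_flows fin_levels_supported)
      (auto simp: w0_eq admissible_poly_def)
  finally have "Abs_fps (\<lambda>m. int (ehrhart_count (CRY (n + 1)) m)) * (1 - fps_X) ^ ((n + 1 choose 2) + 1)
      = hstar n (complete_monom n) *
        (gen_fun (supported {0..n}) (\<lambda>r. sum r {0..n}) * (1 - fps_X) ^ card {0..n})"
    by (simp add: hstar_def card_edge_copies_complete numeral_2_eq_2 power_add mult_ac)
  then show ?thesis
    by (simp only: gen_fun_supported finite_atLeastAtMost mult_1_right)
qed

theorem theorem5p12:
  fixes n :: nat
  assumes "n \<ge> 2"
  shows "(\<exists>Q. is_reduced_poly_of Q (w0 n)) \<and>
    (\<forall>Q. is_reduced_poly_of Q (w0 n) \<longrightarrow>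
       fps_of_poly (pcompose (xeval (\<lambda>_. 1) Q) [:-1, 1:]) =
         Abs_fps (\<lambda>m. int (ehrhart_count (CRY (n + 1)) m)) *
           (1 - fps_X) ^ ((n + 1 choose 2) + 1))"
proof (intro conjI allI impI)
  show "\<exists>Q. is_reduced_poly_of Q (w0 n)"
    by (rule reduction_exists[OF admissible_w0])
next
  fix Q assume Q: "is_reduced_poly_of Q (w0 n)"
  then have steps: "reduction_step\<^sup>*\<^sup>* (w0 n) Q" and red: "fully_reduced Q"
    by (simp_all add: is_reduced_poly_of_def)
  have adm: "admissible_poly n Q" and eq: "hstar_poly n Q = hstar_poly n (w0 n)"
    using reduction_steps_invariant[OF steps admissible_w0] by blast+
  \<comment> \<open>The polynomial \<open>w0 n\<close> is a single monomial with coefficient 1, so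
    the invariant starts at \<open>hstar\<close> of the complete graph.\<close>
  have "shift_coeff (xeval (\<lambda>_. 1) Q) = hstar n (complete_monom n)"
    using eq unfolding hstar_poly_reduced[OF red adm]
    by (simp add: w0_eq hstar_poly_single shift_coeff_simps)
  then show "fps_of_poly (pcompose (xeval (\<lambda>_. 1) Q) [:-1, 1:]) =
      Abs_fps (\<lambda>m. int (ehrhart_count (CRY (n + 1)) m)) * (1 - fps_X) ^ ((n + 1 choose 2) + 1)"
    unfolding ehrhart_series_CRY by (simp only: shift_coeff_def)
qed

end
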